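(* For all real $x>0$ and $k>0$, $$\frac{2\beta_k(x)\,\beta_k(k^2/x)}{\beta_k(x)+\beta_k(k^2/x)}\le\beta_k(k)=\frac{\ln 2}{k},$$ and equality holds for $x=k$.
   Context: For $k>0$ and $x>0$, the Nielsen $k$-beta function is $\beta_k(x)=\int_0^1\frac{t^{x-1}}{1+t^k}\,dt$. *)

theory Defs
  imports "HOL-Analysis.Analysis"
begin

(* For x < 1 the integrand is unbounded near 0; the gauge integral covers this improper
   integral. The totalised value 0 powr (x - 1) = 0 at the endpoint affects only a null set. *)
definition nielsen_k_beta :: "real \<Rightarrow> real \<Rightarrow> real" where
  "nielsen_k_beta k x = integral {0..1} (\<lambda>t. t powr (x - 1) / (1 + t powr k))"

(* The integral converges for all admissible arguments, so nielsen_k_beta never takes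
   the default value of a divergent integral there. *)
lemma nielsen_k_beta_integrable:
  fixes k x :: real
  assumes "k > 0" and "x > 0"
  shows "(\<lambda>t. t powr (x - 1) / (1 + t powr k)) integrable_on {0..1}"
proof (rule measurable_bounded_by_integrable_imp_integrable)
  show "(\<lambda>t. t powr (x - 1)) integrable_on {0..1::real}"
    using has_integral_powr_from_0[of "x - 1" 1] assms by (auto simp: integrable_on_def)
  show "(\<lambda>t. t powr (x - 1) / (1 + t powr k)) \<in> borel_measurable (lebesgue_on {0..1})"
    by (intro measurable_restrict_space1 measurable_completion) measurable
  show "norm (t powr (x - 1) / (1 + t powr k)) \<le> t powr (x - 1)" if "t \<in> {0..1}" for t :: real
    by (simp add: divide_le_eq abs_of_nonneg add_nonneg_nonneg mult_le_cancel_left1 add_pos_nonneg)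
qed auto

end

theory Submission
  imports Defs "HOL-Real_Asymp.Real_Asymp"
begin

text \<open>
  In the variable \<open>s = t\<^sup>k\<close>, replace \<open>1 / (1 + s)\<close> by a multiple
  \<open>A s\<^sup>-\<^sup>b\<close> of a power that has the same integral and the same logarithmic moment
  against \<open>t\<^sup>k\<^sup>-\<^sup>1 dt\<close>. The concave function \<open>s\<^sup>b - A (1 + s)\<close> is positive exactly
  between two zeros \<open>p < q\<close>, while \<open>t\<^sup>x\<^sup>-\<^sup>k\<close>, being convex in \<open>ln t\<close>, lies below its chord (affine
  in \<open>ln t\<close>) exactly there. As both moments of the difference vanish, subtracting the chord
  costs nothing, and \<open>\<beta>\<^sub>k(x) \<le> A / (x - k b)\<close> follows, with equality at \<open>x = k\<close>.
  So \<open>1 / \<beta>\<^sub>k\<close> lies above an increasing affine function that touches it at \<open>k\<close>, and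
  \<open>x + k\<^sup>2 / x \<ge> 2 k\<close> bounds the harmonic mean.
\<close>

section \<open>Sign of a convex function with two zeros\<close>

text \<open>Between the zeros the graph lies below a chord of height 0. Outside, the nearer zero
  lies inside the chord from \<open>t\<close> to the farther zero, so that chord cannot start below
  0. It is applied once in s and once in ln s.\<close>

lemma convex_on_zeros_sign:
  fixes f :: "real \<Rightarrow> real"
  assumes "convex_on S f" "a \<in> S" "b \<in> S" "t \<in> S" "a < b" "f a = 0" "f b = 0"
  shows "a \<le> t \<Longrightarrow> t \<le> b \<Longrightarrow> f t \<le> 0" and "t \<le> a \<or> b \<le> t \<Longrightarrow> 0 \<le> f t"
proof -
  have chord: "f y * (z - x) \<le> f x * (z - y) + f z * (y - x)"
    if "x \<in> S" "z \<in> S" "x < y" "y < z" for x y z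
  proof -
    define u where "u = (y - x) / (z - x)"
    have u: "0 \<le> u" "u \<le> 1" "1 - u = (z - y) / (z - x)"
      using that by (auto simp: u_def divide_simps)
    have "u * (z - x) = y - x"
      using that by (simp add: u_def)
    then have y: "(1 - u) *\<^sub>R x + u *\<^sub>R z = y"
      by (simp add: algebra_simps)
    have "f y \<le> (1 - u) * f x + u * f z"
      using convex_onD[OF assms(1) u(1,2) that(1,2)] y by simp
    also have "\<dots> = ((z - y) * f x + (y - x) * f z) / (z - x)"
      unfolding u(3) by (simp add: u_def add_divide_distrib)
    finally show ?thesis
      using that by (simp add: pos_le_divide_eq algebra_simps)
  qed
  show "f t \<le> 0" if "a \<le> t" "t \<le> b"
  proof (cases "t = a \<or> t = b")
    case False
    then have "f t * (b - a) \<le> 0"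
      using chord[of a b t] assms that by auto
    then show ?thesis
      using \<open>a < b\<close> by (simp add: mult_le_0_iff)
  qed (use assms in auto)
  show "0 \<le> f t" if t: "t \<le> a \<or> b \<le> t"
  proof -
    consider "t = a \<or> t = b" | "t < a" | "b < t"
      using t by force
    then show ?thesis
    proof cases
      case 2
      then have "0 \<le> f t * (b - a)"
        using chord[of t b a] assms by auto
      then show ?thesis
        using \<open>a < b\<close> by (simp add: zero_le_mult_iff)
    next
      case 3
      then have "0 \<le> f t * (b - a)"
        using chord[of a t b] assms by auto
      then show ?thesis
        using \<open>a < b\<close> by (simp add: zero_le_mult_iff)
    qed (use assms in auto)
  qed
qed

section \<open>Power and logarithmic moments on [0,1]\<close>

lemma has_integral_powr_01:
  fixes a :: real
  assumes "0 < a"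
  shows "((\<lambda>t. t powr (a - 1)) has_integral 1 / a) {0..1}"
  using has_integral_powr_from_0[of "a - 1" 1] assms by simp

lemma tendsto_powr_mult_ln_at_right_0:
  fixes a :: real
  assumes "0 < a"
  shows "((\<lambda>t. t powr a * ln t) \<longlongrightarrow> 0) (at_right 0)"
  using assms by real_asymp

lemma has_integral_ln_powr_01:
  fixes a :: real
  assumes "0 < a"
  shows "((\<lambda>t. ln t * t powr (a - 1)) has_integral - 1 / a\<^sup>2) {0..1}"
proof -
  define F where "F t = t powr a * ln t / a - t powr a / a\<^sup>2" for t :: real
  have "((\<lambda>t. ln t * t powr (a - 1)) has_integral F 1 - F 0) {0..1}"
  proof (rule fundamental_theorem_of_calculus_interior)
    \<comment> \<open>At 0 the totalised value is 0, since \<open>0 powr a = 0\<close>, and it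
      agrees with the limit from the right.\<close>
    have "continuous (at t within {0..1}) (\<lambda>t. t powr a * ln t)" if "t \<in> {0..1}" for t :: real
    proof (cases "t = 0")
      case True
      then show ?thesis
        using tendsto_powr_mult_ln_at_right_0[OF assms]
        by (simp add: continuous_within at_within_Icc_at_right)
    next
      case False
      then have "isCont (\<lambda>t. t powr a * ln t) t"
        by (intro continuous_intros) auto
      then show ?thesis
        by (rule continuous_at_imp_continuous_at_within)
    qed
    then have cont: "continuous_on {0..1} (\<lambda>t::real. t powr a * ln t)"
      by (simp add: continuous_on_eq_continuous_within)
    show "continuous_on {0..1} F"
      unfolding F_def using assms
      by (intro cont continuous_on_diff continuous_on_divide continuous_on_powr'
            continuous_on_id continuous_on_const) auto
    show "(F has_vector_derivative ln t * t powr (a - 1)) (at t)" if "t \<in> {0<..<1}" for t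
      unfolding F_def has_real_derivative_iff_has_vector_derivative[symmetric]
      using that assms
      by (auto intro!: derivative_eq_intros simp: powr_diff power2_eq_square field_simps)
  qed auto
  then show ?thesis
    by (simp add: F_def)
qed

section \<open>Positivity, the value at k and the logarithmic moment\<close>

lemma nielsen_k_beta_pos:
  assumes "0 < k" "0 < x"
  shows "0 < nielsen_k_beta k x"
proof -
  have "((\<lambda>t. t powr (x - 1) / 2) has_integral 1 / x / 2) {0..1}"
    by (intro has_integral_divide has_integral_powr_01 assms)
  moreover have "((\<lambda>t. t powr (x - 1) / (1 + t powr k)) has_integral nielsen_k_beta k x) {0..1}"
    unfolding nielsen_k_beta_def by (intro integrable_integral nielsen_k_beta_integrable assms)
  ultimately have "1 / x / 2 \<le> nielsen_k_beta k x"
  proof (rule has_integral_le)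
    fix t :: real assume "t \<in> {0..1}"
    then have "t powr k \<le> 1"
      using assms by (simp add: powr_le1)
    then show "t powr (x - 1) / 2 \<le> t powr (x - 1) / (1 + t powr k)"
      by (intro divide_left_mono) (auto intro: add_pos_nonneg)
  qed
  with assms show ?thesis
    by (smt (verit) divide_pos_pos)
qed

lemma nielsen_k_beta_self:
  assumes "0 < k"
  shows "nielsen_k_beta k k = ln 2 / k"
proof -
  define F where "F t = ln (1 + t powr k) / k" for t
  have "((\<lambda>t. t powr (k - 1) / (1 + t powr k)) has_integral F 1 - F 0) {0..1}"
  proof (rule fundamental_theorem_of_calculus_interior)
    show "continuous_on {0..1} F"
      unfolding F_def using assms
      by (intro continuous_intros continuous_on_powr') (auto simp: add_nonneg_eq_0_iff)
    show "(F has_vector_derivative t powr (k - 1) / (1 + t powr k)) (at t)" if "t \<in> {0<..<1}" for t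
    proof -
      have "0 < 1 + t powr k"
        by (intro add_pos_nonneg) auto
      then have "(F has_real_derivative 1 / (1 + t powr k) * (k * t powr (k - 1)) / k) (at t)"
        unfolding F_def using that assms by (auto intro!: derivative_eq_intros)
      then show ?thesis
        using assms by (simp add: has_real_derivative_iff_has_vector_derivative)
    qed
  qed auto
  then show ?thesis
    by (simp add: F_def nielsen_k_beta_def integral_unique)
qed

text \<open>The bounds are the partial sums 1 - 1/4 + 1/9 and 1 - 1/4 + 1/9 - 1/16 of the
  alternating series for J = pi^2/12.\<close>

lemma nielsen_log_moment:
  fixes k :: real
  assumes "0 < k"
  obtains J where "115 / 144 \<le> J" "J \<le> 31 / 36"
    "((\<lambda>t. ln t * (t powr (k - 1) / (1 + t powr k))) has_integral - J / k\<^sup>2) {0..1}"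
proof -
  let ?f = "\<lambda>t::real. ln t * (t powr (k - 1) / (1 + t powr k))"
  have pw: "t powr (n * k - 1) = t powr (k - 1) * (t powr k) ^ m" if "n = 1 + real m" for t n m
  proof -
    have "(t powr k) ^ m = t powr (k * m)" if "t \<noteq> 0"
      using powr_realpow[of "t powr k" m] that by (simp add: powr_powr)
    then show ?thesis
      by (cases "t = 0") (simp_all add: that algebra_simps flip: powr_add)
  qed
  have mom: "((\<lambda>t. ln t * t powr (n * k - 1)) has_integral - 1 / (n * k)\<^sup>2) {0..1}" if "0 < n" for n
    using that assms by (intro has_integral_ln_powr_01) auto
  \<comment> \<open>from \<open>1 - s + s\<^sup>2 - s\<^sup>3 \<le> 1 / (1 + s) \<le> 1 - s + s\<^sup>2\<close>; the factor \<open>ln t \<le> 0\<close> swaps the bounds\<close>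
  let ?u = "\<lambda>t. ln t * t powr (1 * k - 1) - ln t * t powr (2 * k - 1) + ln t * t powr (3 * k - 1)"
  let ?l = "\<lambda>t. ?u t - ln t * t powr (4 * k - 1)"
  have u: "(?u has_integral - (31/36) / k\<^sup>2) {0..1}"
    using has_integral_add[OF has_integral_diff[OF mom[of 1] mom[of 2]] mom[of 3]] assms
    by (simp add: power_mult_distrib field_simps)
  have l: "(?l has_integral - (115/144) / k\<^sup>2) {0..1}"
    using has_integral_diff[OF u mom[of 4]] assms
    by (simp add: power_mult_distrib field_simps)
  have bnd: "?u t \<le> ?f t \<and> ?f t \<le> ?l t" if t: "t \<in> {0..1}" for t
  proof -
    define s where "s = t powr k"
    define w where "w = ln t * t powr (k - 1)"
    have s: "0 \<le> s" "s \<le> 1"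
      using t assms by (auto simp: s_def powr_le1)
    have w: "w \<le> 0"
      using t by (cases "t = 0") (auto simp: w_def intro!: mult_nonpos_nonneg)
    have "1 / (1 + s) \<le> 1 - s + s\<^sup>2" "1 - s + s\<^sup>2 - s ^ 3 \<le> 1 / (1 + s)"
      using s by (simp_all add: field_simps power2_eq_square power3_eq_cube)
    then have "w * (1 - s + s\<^sup>2) \<le> w * (1 / (1 + s))" "w * (1 / (1 + s)) \<le> w * (1 - s + s\<^sup>2 - s ^ 3)"
      using mult_left_mono_neg[OF _ w] by blast+
    moreover have "t powr (2 * k - 1) = t powr (k - 1) * s" "t powr (3 * k - 1) = t powr (k - 1) * s\<^sup>2"
      "t powr (4 * k - 1) = t powr (k - 1) * s ^ 3"
      using pw[of 2 1 t] pw[of 3 2 t] pw[of 4 3 t] by (simp_all add: s_def)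
    ultimately show ?thesis
      by (simp add: w_def s_def[symmetric] algebra_simps)
  qed
  \<comment> \<open>As \<open>?f\<close> is nonpositive, its lower bound \<open>?u\<close> also
    controls its absolute value.\<close>
  have int: "?f integrable_on {0..1}"
  proof (rule measurable_bounded_by_integrable_imp_integrable)
    show "(\<lambda>t. - ?u t) integrable_on {0..1}"
      using has_integral_neg[OF u] by blast
    show "?f \<in> borel_measurable (lebesgue_on {0..1})"
      by (intro measurable_restrict_space1 measurable_completion) measurable
    show "norm (?f t) \<le> - ?u t" if "t \<in> {0..1}" for t
    proof -
      have "?f t \<le> 0"
        using that by (cases "t = 0") (simp, intro mult_nonpos_nonneg, auto)
      then show ?thesis
        using bnd[OF that] unfolding real_norm_def by linarith
    qed
  qed auto
  define J where "J = - k\<^sup>2 * integral {0..1} ?f"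
  have f: "(?f has_integral - J / k\<^sup>2) {0..1}"
    using integrable_integral[OF int] assms by (simp add: J_def)
  have "- (31/36) / k\<^sup>2 \<le> - J / k\<^sup>2" "- J / k\<^sup>2 \<le> - (115/144) / k\<^sup>2"
    using has_integral_le[OF u f] has_integral_le[OF f l] bnd by blast+
  then have "J \<le> 31/36" "115/144 \<le> J"
    using assms by (simp_all only: divide_le_cancel) auto
  with f show thesis
    using that by blast
qed

text \<open>The last assumption makes \<open>s powr b - A * (1 + s)\<close> positive at \<open>s = 1/4\<close>, via
  \<open>exp y \<ge> 1 + y\<close>.\<close>
lemma power_minus_affine_zeros:
  fixes A b :: real
  assumes "0 < b" "b < 1" "1 / 2 < A" "A * (5 / 4) < 1 - b * (2 * ln 2)"
  obtains p q where "0 < p" "p < q"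
    "\<And>s. p \<le> s \<Longrightarrow> s \<le> q \<Longrightarrow> A * (1 + s) \<le> s powr b"
    "\<And>s. 0 < s \<Longrightarrow> s \<le> p \<or> q \<le> s \<Longrightarrow> s powr b \<le> A * (1 + s)"
proof -
  define g where "g s = A * (1 + s) - s powr b" for s
  have conv: "convex_on {0<..} g"
    unfolding g_def
  proof (rule f''_ge0_imp_convex)
    show "((\<lambda>s. A * (1 + s) - s powr b) has_real_derivative A - b * s powr (b - 1)) (at s)"
      if "s \<in> {0<..}" for s
      using that by (auto intro!: derivative_eq_intros)
    show "((\<lambda>s. A - b * s powr (b - 1)) has_real_derivative b * (1 - b) * s powr (b - 2)) (at s)"
      if "s \<in> {0<..}" for s
      using that by (auto intro!: derivative_eq_intros simp: algebra_simps)
  qed (use assms in auto)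
  \<comment> \<open>At s = 1/4 the exponent is a multiple of ln 2, the constant from which A and b
    are later built.\<close>
  have ln4: "ln 4 = 2 * ln (2::real)"
    using ln_realpow[of 2 2] by simp
  have "g 0 > 0" "g 1 > 0"
    using assms by (auto simp: g_def)
  have "(1/4) powr b = exp (- (b * (2 * ln 2)))"
    by (simp add: powr_def ln_div ln4)
  also have "\<dots> \<ge> 1 - b * (2 * ln 2)"
    using exp_ge_add_one_self[of "- (b * (2 * ln 2))"] by simp
  finally have "g (1/4) < 0"
    using assms by (simp add: g_def)
  have cont: "continuous_on {0..1} g"
    unfolding g_def using assms by (intro continuous_intros continuous_on_powr') auto
  \<comment> \<open>The signs +, -, + of \<open>g\<close> at 0, 1/4, 1 place one zero on each side
    of 1/4.\<close>
  obtain p where p: "0 \<le> p" "p \<le> 1/4" "g p = 0"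
    using IVT2'[of g "1/4" 0 0] \<open>g 0 > 0\<close> \<open>g (1/4) < 0\<close> continuous_on_subset[OF cont] by force
  obtain q where q: "1/4 \<le> q" "q \<le> 1" "g q = 0"
    using IVT'[of g "1/4" 0 1] \<open>g 1 > 0\<close> \<open>g (1/4) < 0\<close> continuous_on_subset[OF cont] by force
  have "p \<noteq> 1/4"
    using p(3) \<open>g (1/4) < 0\<close> by (metis less_irrefl)
  then have pq: "0 < p" "p < q"
    using p q \<open>g 0 > 0\<close> \<open>g (1/4) < 0\<close> by (auto simp: less_le)
  show thesis
  proof (rule that[OF pq])
    show "A * (1 + s) \<le> s powr b" if "p \<le> s" "s \<le> q" for s
      using convex_on_zeros_sign(1)[OF conv, of p q s] p q pq that by (auto simp: g_def)
    show "s powr b \<le> A * (1 + s)" if "0 < s" "s \<le> p \<or> q \<le> s" for s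
      using convex_on_zeros_sign(2)[OF conv, of p q s] p q pq that by (auto simp: g_def)
  qed
qed

section \<open>The affine lower bound for 1 / beta_k\<close>

text \<open>This is the affine bound on 1 / beta_k with denominators cleared;
  \<open>A / (1 - b) = ln 2\<close> makes it an equality at x = k.\<close>

lemma nielsen_k_beta_inverse_affine_bound:
  fixes k :: real
  assumes "0 < k"
  obtains A b where "0 < A" "A / (1 - b) = ln 2" "b < 1"
    "\<And>x. 0 < x \<Longrightarrow> nielsen_k_beta k x * (x - k * b) \<le> A"
proof -
  obtain J where J: "115 / 144 \<le> J" "J \<le> 31 / 36"
    and Jint: "((\<lambda>t. ln t * (t powr (k - 1) / (1 + t powr k))) has_integral - J / k\<^sup>2) {0..1}"
    using nielsen_log_moment[OF assms] .
  define L where "L = ln (2::real)"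
  \<comment> \<open>the solution of the two moment equations \<open>A / (1 - b) = L\<close> and \<open>A / (1 - b)\<^sup>2 = J\<close>\<close>
  define b where "b = 1 - L / J"
  define A where "A = L\<^sup>2 / J"
  have L: "2 / 3 \<le> L" "L \<le> 25 / 36"
    using ln2_ge_two_thirds ln2_le_25_over_36 by (auto simp: L_def)
  have b: "0 < b" "b < 1"
    using L J by (auto simp: b_def)
  \<comment> \<open>With \<open>J \<le> 31 / 36\<close> this gives A >= 16/31 > 1/2.\<close>
  have "(2/3)\<^sup>2 \<le> L\<^sup>2"
    using L by (intro power_mono) auto
  then have A: "1 / 2 < A" "0 < A"
    using J by (auto simp: A_def field_simps power2_eq_square)
  have Ab: "A / (1 - b) = L" "A / (1 - b)\<^sup>2 = J"
    using L J by (simp_all add: A_def b_def power2_eq_square)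
  have "A * (5 / 4) < 1 - b * (2 * ln 2)"
  proof -
    \<comment> \<open>In terms of L and J the claim is 0 < 1 - 2 L + (3/4) L^2 / J, and J <= 31/36
      turns 3/4 into 27/31. The product is h(L) - h(25/36) for h(L) = 1 - 2 L + (27/31) L^2, and
      h(25/36) > 0.\<close>
    have "0 \<le> (25/36 - L) * (2 - 27/31 * (25/36 + L))"
      using L by (intro mult_nonneg_nonneg) auto
    also have "\<dots> = 25/18 - 2 * L - 27/31 * (25/36)\<^sup>2 + 27/31 * L\<^sup>2"
      by (simp add: field_simps power2_eq_square)
    also have "\<dots> < 1 - 2 * L + 27/31 * L\<^sup>2"
      by (simp add: power2_eq_square)
    finally have "0 < 1 - 2 * L + 27/31 * L\<^sup>2" .
    also have "27/31 * L\<^sup>2 \<le> 3/4 * L\<^sup>2 / J"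
      using J mult_right_mono[OF J(2), of "L\<^sup>2"] by (simp add: field_simps)
    finally have "0 < 1 - 2 * L + 3/4 * L\<^sup>2 / J"
      by simp
    then show ?thesis
      unfolding L_def[symmetric] A_def b_def by (simp add: algebra_simps power2_eq_square)
  qed
  then obtain p q where pq: "0 < p" "p < q"
    and inside: "\<And>s. p \<le> s \<Longrightarrow> s \<le> q \<Longrightarrow> A * (1 + s) \<le> s powr b"
    and outside: "\<And>s. 0 < s \<Longrightarrow> s \<le> p \<or> q \<le> s \<Longrightarrow> s powr b \<le> A * (1 + s)"
    using power_minus_affine_zeros[OF b A(1)] by metis
  have "nielsen_k_beta k x * (x - k * b) \<le> A" if "0 < x" for x
  proof (cases "x \<le> k * b")
    \<comment> \<open>Here the comparison power t^(x - k b - 1) is not integrable at 0, but the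
      left-hand side is nonpositive.\<close>
    case True
    then have "nielsen_k_beta k x * (x - k * b) \<le> 0"
      using nielsen_k_beta_pos[OF assms that] by (simp add: mult_nonneg_nonpos)
    then show ?thesis
      using A by simp
  next
    case False
    \<comment> \<open>\<open>D x\<close> is t^(x - k) times \<open>D k\<close>, and the choice of A
      and b makes the integrals of \<open>D k\<close> and of ln t times \<open>D k\<close>
      vanish.\<close>
    define D where "D y t = t powr (y - 1) / (1 + t powr k) - A * t powr (y - k * b - 1)" for y t
    have D: "(D y has_integral nielsen_k_beta k y - A * (1 / (y - k * b))) {0..1}"
      if "0 < y" "k * b < y" for y
      unfolding D_def nielsen_k_beta_def using that assms
      by (intro has_integral_diff integrable_integral nielsen_k_beta_integrable
            has_integral_mult_right has_integral_powr_01) auto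
    have kb: "k * b < k"
      using b assms by simp
    have kb': "k - k * b = k * (1 - b)"
      by (simp add: algebra_simps)
    have "A * (1 / (k - k * b)) = L / k"
      unfolding kb' Ab(1)[symmetric] by simp
    then have D0: "(D k has_integral 0) {0..1}"
      using D[OF assms kb] nielsen_k_beta_self[OF assms] by (simp add: L_def)
    have "A * (- 1 / (k - k * b)\<^sup>2) = - J / k\<^sup>2"
      unfolding kb' Ab(2)[symmetric] by (simp add: power_mult_distrib)
    then have D1: "((\<lambda>t. ln t * D k t) has_integral 0) {0..1}"
      using has_integral_diff[OF Jint has_integral_mult_right[OF has_integral_ln_powr_01, of "k - k * b" A]] kb
      by (simp add: D_def algebra_simps)
    \<comment> \<open>\<open>E\<close> is \<open>t powr (x - k)\<close> minus its chord, in the variable \<open>y = k * ln t\<close>\<close>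
    define r where "r = x / k - 1"
    define m where "m = (exp (r * ln q) - exp (r * ln p)) / (ln q - ln p)"
    define c where "c = exp (r * ln p) - m * ln p"
    define E where "E y = exp (r * y) - m * y - c" for y
    have conv: "convex_on UNIV E"
      unfolding E_def
    proof (rule f''_ge0_imp_convex)
      show "((\<lambda>y. exp (r * y) - m * y - c) has_real_derivative r * exp (r * y) - m) (at y)" for y
        by (auto intro!: derivative_eq_intros)
      show "((\<lambda>y. r * exp (r * y) - m) has_real_derivative r * r * exp (r * y)) (at y)" for y
        by (auto intro!: derivative_eq_intros)
    qed auto
    have lnpq: "ln p < ln q"
      using pq by simp
    have Epq: "E (ln p) = 0" "E (ln q) = 0"
      using lnpq by (simp_all add: E_def c_def m_def field_simps)
    \<comment> \<open>For t > 0 and s = t^k this says \<open>E (ln s) * D k t \<le> 0\<close>: the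
      two factors change sign at the same points p and q, in opposite directions. At t = 0 both
      sides are 0.\<close>
    have "D x t \<le> c * D k t + (m * k) * (ln t * D k t)" if "t \<in> {0..1}" for t
    proof (cases "t = 0")
      case False
      define s where "s = t powr k"
      have t: "0 < t" and s: "0 < s" and lns: "ln s = k * ln t"
        using False that by (auto simp: s_def ln_powr)
      have "D k t = t powr (k - k * b - 1) / (1 + s) * (s powr b - A * (1 + s))"
      proof -
        have "t powr (k - k * b - 1) * s powr b = t powr (k - 1)"
          using t by (simp add: s_def powr_powr flip: powr_add)
        moreover have "1 + s \<noteq> 0"
          using s by simp
        ultimately show ?thesis
          by (simp add: D_def s_def[symmetric] field_simps)
      qed
      moreover have "E (ln s) * (s powr b - A * (1 + s)) \<le> 0"
      proof (cases "p \<le> s \<and> s \<le> q")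
        case True
        then have "ln p \<le> ln s" "ln s \<le> ln q"
          using pq s by auto
        then have "E (ln s) \<le> 0"
          using convex_on_zeros_sign(1)[OF conv _ _ _ lnpq Epq] by simp
        then show ?thesis
          using inside True by (intro mult_nonpos_nonneg) auto
      next
        case False
        then have "ln s \<le> ln p \<or> ln q \<le> ln s"
          using pq s by auto
        then have "0 \<le> E (ln s)"
          using convex_on_zeros_sign(2)[OF conv _ _ _ lnpq Epq] by simp
        then show ?thesis
          using outside[OF s] False by (intro mult_nonneg_nonpos) auto
      qed
      ultimately have "E (ln s) * D k t \<le> 0"
        using s mult_nonneg_nonpos[of "t powr (k - k * b - 1) / (1 + s)"
            "E (ln s) * (s powr b - A * (1 + s))"]
        by (simp add: mult.left_commute)
      moreover have "exp (r * ln s) = t powr (x - k)"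
        using t assms by (simp add: lns r_def powr_def field_simps)
      then have "exp (r * ln s) * D k t = D x t"
        by (simp add: D_def algebra_simps flip: powr_add)
      ultimately show ?thesis
        by (simp add: E_def lns algebra_simps)
    qed (simp add: D_def)
    then have "nielsen_k_beta k x - A * (1 / (x - k * b)) \<le> c * 0 + (m * k) * 0"
      using False that
      by (intro has_integral_le[OF D has_integral_add[OF has_integral_mult_right[OF D0]
              has_integral_mult_right[OF D1]]]) auto
    then show ?thesis
      using False by (simp add: pos_le_divide_eq)
  qed
  then show thesis
    using that[of A b] A b Ab by (simp add: L_def)
qed

section \<open>The harmonic mean inequality\<close>

theorem theorem5p6:
  fixes k x :: real
  assumes "k > 0" and "x > 0"
  shows "2 * nielsen_k_beta k x * nielsen_k_beta k (k\<^sup>2 / x)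
           / (nielsen_k_beta k x + nielsen_k_beta k (k\<^sup>2 / x)) \<le> nielsen_k_beta k k
       \<and> nielsen_k_beta k k = ln 2 / k
       \<and> (x = k \<longrightarrow> 2 * nielsen_k_beta k x * nielsen_k_beta k (k\<^sup>2 / x)
           / (nielsen_k_beta k x + nielsen_k_beta k (k\<^sup>2 / x)) = nielsen_k_beta k k)"
proof (intro conjI impI)
  define u v where "u = nielsen_k_beta k x" and "v = nielsen_k_beta k (k\<^sup>2 / x)"
  have pos: "0 < u" "0 < v"
    using assms by (simp_all add: u_def v_def nielsen_k_beta_pos)
  obtain A b where A: "0 < A" "A / (1 - b) = ln 2" "b < 1"
    and bound: "\<And>x. 0 < x \<Longrightarrow> nielsen_k_beta k x * (x - k * b) \<le> A"
    using nielsen_k_beta_inverse_affine_bound[OF assms(1)] by metis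
  have "u * (x - k * b) \<le> A" "v * (k\<^sup>2 / x - k * b) \<le> A"
    using bound[of x] bound[of "k\<^sup>2 / x"] assms by (simp_all add: u_def v_def)
  \<comment> \<open>Weighting each bound by the other beta value brings out the common factor u
    v.\<close>
  then have "v * (u * (x - k * b)) + u * (v * (k\<^sup>2 / x - k * b)) \<le> v * A + u * A"
    using pos by (intro add_mono mult_left_mono) auto
  then have "u * v * (x + k\<^sup>2 / x - 2 * (k * b)) \<le> A * (u + v)"
    by (simp add: algebra_simps)
  moreover have "2 * k \<le> x + k\<^sup>2 / x"
    using assms sum_squares_bound[of x k] by (simp add: field_simps power2_eq_square)
  then have "u * v * (2 * k - 2 * (k * b)) \<le> u * v * (x + k\<^sup>2 / x - 2 * (k * b))"
    using pos by (intro mult_left_mono) auto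
  ultimately have "2 * u * v * (k * (1 - b)) \<le> A * (u + v)"
    by (simp add: algebra_simps)
  then have "2 * u * v / (u + v) \<le> A / (1 - b) / k"
    using pos assms A by (simp add: divide_simps algebra_simps)
  then show "2 * nielsen_k_beta k x * nielsen_k_beta k (k\<^sup>2 / x)
      / (nielsen_k_beta k x + nielsen_k_beta k (k\<^sup>2 / x)) \<le> nielsen_k_beta k k"
    by (simp add: u_def v_def A(2) nielsen_k_beta_self[OF assms(1)])
next
  show "nielsen_k_beta k k = ln 2 / k"
    by (rule nielsen_k_beta_self[OF assms(1)])
next
  assume "x = k"
  then show "2 * nielsen_k_beta k x * nielsen_k_beta k (k\<^sup>2 / x)
      / (nielsen_k_beta k x + nielsen_k_beta k (k\<^sup>2 / x)) = nielsen_k_beta k k"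
    using nielsen_k_beta_pos[OF assms(1) assms(1)] assms by (simp add: power2_eq_square)
qed

end
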